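(* Let $\triangle ABC$ be a triangle and let $A_1,A_2$ on the line $BC$, $B_1,B_2$ on the line $CA$, $C_1,C_2$ on the line $AB$ be six points lying on the same conic $\mathcal{C}$. With the points $A_3,A_4,B_3,B_4,C_3,C_4,D_3,D_4,E_3,E_4,F_3,F_4$ defined in the context, each of the following 8 triples of points is collinear: $(A_3,B_3,C_3)$, $(D_3,E_4,C_4)$, $(A_3,E_4,F_3)$, $(D_3,B_3,F_4)$, $(A_4,E_3,F_4)$, $(D_4,E_3,C_3)$, $(D_4,B_4,F_3)$, and $(A_4,B_4,C_4)$.
   Context: The setting is the real projective plane (containing the Euclidean plane). The six points $A_1,A_2,B_1,B_2,C_1,C_2$ are distinct and different from the vertices $A,B,C$. Let $D_1, D_2, E_1, E_2, F_1, F_2$ be the second intersection points of the conic $\mathcal{C}$ with the lines $AA_1$, $AA_2$, $BB_1$, $BB_2$, $CC_1$, $CC_2$, respectively. Define $$A_3 = C_1B_2\cap E_1F_2,\quad A_4 = B_1C_2\cap F_1E_2,$$ $$B_3 = A_1C_2\cap F_1D_2,\quad B_4 = C_1A_2\cap D_1F_2,$$ $$C_3 = B_1A_2\cap D_1E_2,\quad C_4 = A_1B_2\cap E_1D_2,$$ $$D_3 = B_1C_1\cap E_2F_2,\quad D_4 = B_2C_2\cap E_1F_1,$$ $$E_3 = A_1C_1\cap D_2F_2,\quad E_4 = A_2C_2\cap D_1F_1,$$ $$F_3 = A_1B_1\cap D_2E_2,\quad F_4 = A_2B_2\cap D_1E_1,$$ where $PQ\cap RS$ denotes the intersection point of the lines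 $PQ$ and $RS$. All these points are assumed to be well defined. *)

theory Defs
  imports "HOL-Analysis.Analysis"
begin

text \<open>
  The real projective plane: its points are the one-dimensional linear subspaces of \<open>real ^ 3\<close>.
  The Euclidean plane sits in it as the subspaces spanned by the vectors \<open>vector [x, y, 1]\<close>.
\<close>

typedef proj_point = "{P :: (real ^ 3) set. subspace P \<and> dim P = 1}"
  morphisms subspace_of proj_point_of
proof
  show "span {axis 1 1} \<in> {P :: (real ^ 3) set. subspace P \<and> dim P = 1}"
    by (simp add: dim_insert)
qed

text \<open>
  Lines and conics are treated as sets of points.
\<close>

definition is_proj_line :: "proj_point set \<Rightarrow> bool" where
  "is_proj_line L \<longleftrightarrow>
     (\<exists>W :: (real ^ 3) set. subspace W \<and> dim W = 2 \<and> L = {X. subspace_of X \<subseteq> W})"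

definition proj_collinear :: "proj_point \<Rightarrow> proj_point \<Rightarrow> proj_point \<Rightarrow> bool" where
  "proj_collinear P Q R \<longleftrightarrow> (\<exists>L. is_proj_line L \<and> P \<in> L \<and> Q \<in> L \<and> R \<in> L)"

text \<open>The line \<open>PQ\<close>. It is a line only for \<open>P \<noteq> Q\<close>.\<close>

definition proj_line :: "proj_point \<Rightarrow> proj_point \<Rightarrow> proj_point set" where
  "proj_line P Q = {X. subspace_of X \<subseteq> span (subspace_of P \<union> subspace_of Q)}"

text \<open>
  \<open>X\<close> is the well-defined intersection point of the lines \<open>PQ\<close> and \<open>RS\<close>: both pairs of points
  determine a line, and the two lines have \<open>X\<close> as their only common point (so they are distinct).
\<close>

definition is_intersection ::
    "proj_point \<Rightarrow> proj_point \<Rightarrow> proj_point \<Rightarrow> proj_point \<Rightarrow> proj_point \<Rightarrow> bool" where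
  "is_intersection X P Q R S \<longleftrightarrow>
     P \<noteq> Q \<and> R \<noteq> S \<and> proj_line P Q \<inter> proj_line R S = {X}"

text \<open>
  A conic is the zero set of a nonzero real ternary quadratic form; degenerate conics are included.
\<close>

definition is_conic :: "proj_point set \<Rightarrow> bool" where
  "is_conic K \<longleftrightarrow>
     (\<exists>M :: real ^ 3 ^ 3. transpose M = M \<and> M \<noteq> 0 \<and>
        K = {X. \<forall>v \<in> subspace_of X. v \<bullet> (M *v v) = 0})"

text \<open>
  \<open>X\<close> is the second intersection point of the conic \<open>K\<close> with the line \<open>PQ\<close>, one intersection
  point being \<open>Q\<close>. If \<open>PQ\<close> meets \<open>K\<close> in \<open>Q\<close> only, the intersection has multiplicity two
  and the condition says \<open>X = Q\<close>; if \<open>PQ\<close> is contained in \<open>K\<close>, there is no such \<open>X\<close>.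
\<close>

definition is_second_intersection ::
    "proj_point \<Rightarrow> proj_point set \<Rightarrow> proj_point \<Rightarrow> proj_point \<Rightarrow> bool" where
  "is_second_intersection X K P Q \<longleftrightarrow> P \<noteq> Q \<and> proj_line P Q \<inter> K = {Q, X}"

end

theory Submission
  imports Defs
begin

text \<open>
  Exchanging \<open>A1\<close> with \<open>A2\<close> and \<open>D1\<close> with \<open>D2\<close> preserves the hypotheses, and so do the
  corresponding exchanges on the other two sides. The group of order 8 generated by these three
  exchanges permutes the eight triples transitively, so it is enough to treat \<open>(A3, B3, C3)\<close>.

  For this triple Pascal's theorem is at work twice. In the hexagon \<open>C1 B2 B1 E1 F2 C2\<close>, inscribed
  in the conic, the opposite sides \<open>C1B2\<close> and \<open>E1F2\<close> meet in \<open>A3\<close>, the sides \<open>B2B1 = CA\<close> and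
  \<open>F2C2\<close> meet in \<open>C\<close>, and the sides \<open>B1E1\<close> and \<open>C2C1 = AB\<close> meet in \<open>B\<close>. Hence \<open>A3\<close> lies on
  \<open>BC\<close>, and likewise \<open>B3\<close> on \<open>CA\<close> and \<open>C3\<close> on \<open>AB\<close>. So \<open>A3, B3, C3\<close> are the points in which
  \<open>C1B2, A1C2, B1A2\<close> meet the sides \<open>BC, CA, AB\<close>, that is, the points in which opposite sides of
  the hexagon \<open>A1 C2 C1 B2 B1 A2\<close> meet. They are collinear by Pascal's theorem again.

  The conic may be a pair of lines and the lines \<open>AA1, \<dots>, CC2\<close> may be tangents, so both uses of
  Pascal's theorem are replaced by computations that cover these cases uniformly. Let \<open>a, b, c\<close> be
  vectors representing the vertices, and normalise the six points to \<open>b + u\<^sub>i c\<close>, \<open>c + v\<^sub>i a\<close>,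
  \<open>a + w\<^sub>i b\<close>. That they lie on the conic is then expressed by Vieta's formulas on each side, which
  determine the quadratic form up to a factor (\<open>side_points_coordinates\<close>) and, as the form is not
  zero, imply Carnot's relation \<open>u\<^sub>1 u\<^sub>2 v\<^sub>1 v\<^sub>2 w\<^sub>1 w\<^sub>2 = 1\<close>. A second intersection point has
  coordinates that are polynomial in the form and the given points, valid for secants and tangents
  alike (\<open>second_intersection_coordinates\<close>). The first use of Pascal's theorem becomes the statement
  that \<open>A3\<close> is represented by \<open>v\<^sub>2 w\<^sub>1 b - c\<close> (\<open>intersection_on_side\<close>), and the second becomes the
  linear dependence, by Carnot's relation, of this vector and its two cyclic analogues
  (\<open>pascal_triple_collinear\<close>).
\<close>

section \<open>Homogeneous coordinates\<close>

definition pt :: "real ^ 3 \<Rightarrow> proj_point" where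
  "pt v = proj_point_of (span {v})"

lemma subspace_of_pt:
  assumes "v \<noteq> 0"
  shows "subspace_of (pt v) = span {v}"
  using assms by (simp add: pt_def proj_point_of_inverse dim_insert)

lemma proj_point_cases:
  obtains v where "v \<noteq> 0" "P = pt v"
proof -
  have P: "subspace (subspace_of P)" "dim (subspace_of P) = 1"
    using subspace_of[of P] by auto
  obtain B where B: "B \<subseteq> subspace_of P" "independent B" "subspace_of P \<subseteq> span B"
    "card B = dim (subspace_of P)"
    using basis_exists by blast
  obtain v where v: "B = {v}"
    using B(4) P(2) by (auto simp: card_1_singleton_iff)
  have "v \<noteq> 0"
    using B(2) v by (simp add: dependent_zero)
  moreover have "subspace_of P = span {v}"
    using B(1,3) P(1) v by (metis span_subspace)
  then have "P = pt v"
    by (metis pt_def subspace_of_inverse)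
  ultimately show thesis
    using that by blast
qed

lemma pt_scale:
  assumes "k \<noteq> 0"
  shows "pt (k *\<^sub>R v) = pt v"
  using assms by (simp add: pt_def span_image_scale[of "{v}" "\<lambda>_. k", simplified])

lemma pt_eqD:
  assumes "pt x = pt y" "x \<noteq> 0" "y \<noteq> 0"
  obtains k where "k \<noteq> 0" "x = k *\<^sub>R y"
proof -
  have "x \<in> span {y}"
    using assms by (metis span_base singletonI subspace_of_pt)
  then obtain k where "x = k *\<^sub>R y"
    by (auto simp: span_singleton)
  with assms(2) that show thesis by fastforce
qed

lemma in_span_pair_iff:
  fixes x :: "'a::real_vector"
  shows "x \<in> span {p, q} \<longleftrightarrow> (\<exists>s t. x = s *\<^sub>R p + t *\<^sub>R q)"
  by (auto simp: span_insert span_singleton algebra_simps)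

lemma pt_in_proj_line_iff:
  assumes "x \<noteq> 0" "p \<noteq> 0" "q \<noteq> 0"
  shows "pt x \<in> proj_line (pt p) (pt q) \<longleftrightarrow> (\<exists>s t. x = s *\<^sub>R p + t *\<^sub>R q)"
proof -
  have "span (span {p} \<union> span {q}) = span {p, q}"
    using span_Un[of "{p}" "{q}"] span_Un[of "span {p}" "span {q}"]
    by (simp add: span_span insert_is_Un[of p "{q}"])
  then have "pt x \<in> proj_line (pt p) (pt q) \<longleftrightarrow> x \<in> span {p, q}"
    using assms span_minimal[OF _ subspace_span, of "{x}" "{p, q}"] span_base[of x "{x}"]
    by (auto simp: proj_line_def subspace_of_pt)
  then show ?thesis
    by (simp add: in_span_pair_iff)
qed

text \<open>
  The covector \<open>n\<close> gives the equation of the common line.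
\<close>

lemma proj_collinear_if_orthogonal:
  assumes "x \<noteq> 0" "y \<noteq> 0" "z \<noteq> 0"
    and "n \<noteq> 0" "n \<bullet> x = 0" "n \<bullet> y = 0" "n \<bullet> z = 0"
  shows "proj_collinear (pt x) (pt y) (pt z)"
proof -
  let ?W = "{v. n \<bullet> v = 0}"
  have W: "subspace ?W" "dim ?W = 2"
    using assms(4) by (simp_all add: subspace_hyperplane dim_hyperplane)
  have "span {v} \<subseteq> ?W" if "n \<bullet> v = 0" for v
    using that W(1) by (simp add: span_minimal)
  then show ?thesis
    unfolding proj_collinear_def is_proj_line_def using W assms
    by (intro exI[of _ "{X. subspace_of X \<subseteq> ?W}"]) (auto simp: subspace_of_pt)
qed

lemma proj_collinear_if_dependent:
  assumes "x \<noteq> 0" "y \<noteq> 0" "z \<noteq> 0" and "x = s *\<^sub>R y + t *\<^sub>R z"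
  shows "proj_collinear (pt x) (pt y) (pt z)"
proof -
  have "dim {y, z} < DIM(real ^ 3)"
    using dim_le_card'[of "{y, z}"] card_insert_le_m1[of 2 "{z}" y] by simp
  then obtain n where n: "n \<noteq> 0" "span {y, z} \<subseteq> {v. n \<bullet> v = 0}"
    using lowdim_subset_hyperplane by blast
  then have "n \<bullet> y = 0" "n \<bullet> z = 0"
    by (auto dest: subsetD[OF _ span_base])
  with n(1) assms show ?thesis
    by (intro proj_collinear_if_orthogonal) (auto simp: inner_add_right)
qed

lemma triangle_first_coefficient:
  assumes "\<not> proj_collinear (pt a) (pt b) (pt c)" "a \<noteq> 0" "b \<noteq> 0" "c \<noteq> 0"
    and zero: "r *\<^sub>R a + s *\<^sub>R b + t *\<^sub>R c = 0"
  shows "r = 0"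
proof (rule ccontr)
  assume "r \<noteq> 0"
  then have "a = (1 / r) *\<^sub>R (r *\<^sub>R a + s *\<^sub>R b + t *\<^sub>R c) + (- s / r) *\<^sub>R b + (- t / r) *\<^sub>R c"
    by (simp add: scaleR_add_right)
  then have "a = (- s / r) *\<^sub>R b + (- t / r) *\<^sub>R c"
    unfolding zero by simp
  then show False
    using proj_collinear_if_dependent assms by blast
qed

lemma triangle_independent:
  assumes tri: "\<not> proj_collinear (pt a) (pt b) (pt c)" and nz: "a \<noteq> 0" "b \<noteq> 0" "c \<noteq> 0"
    and zero: "r *\<^sub>R a + s *\<^sub>R b + t *\<^sub>R c = 0"
  shows "r = 0 \<and> s = 0 \<and> t = 0"
proof -
  have r: "r = 0"
    by (rule triangle_first_coefficient[OF tri nz zero])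
  have "\<not> proj_collinear (pt b) (pt a) (pt c)"
    using tri unfolding proj_collinear_def by blast
  moreover have "s *\<^sub>R b + r *\<^sub>R a + t *\<^sub>R c = 0"
    using zero by (simp add: add.commute)
  ultimately have "s = 0"
    using triangle_first_coefficient nz by blast
  with r zero nz show ?thesis
    by simp
qed

section \<open>The quadratic form of the conic\<close>

definition form :: "real ^ 3 ^ 3 \<Rightarrow> real ^ 3 \<Rightarrow> real ^ 3 \<Rightarrow> real" where
  "form M x y = x \<bullet> (M *v y)"

definition conic_of :: "real ^ 3 ^ 3 \<Rightarrow> proj_point set" where
  "conic_of M = {X. \<forall>v \<in> subspace_of X. v \<bullet> (M *v v) = 0}"

lemma form_linear:
  "form M (x + y) z = form M x z + form M y z"
  "form M z (x + y) = form M z x + form M z y"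
  "form M (k *\<^sub>R x) z = k * form M x z"
  "form M z (k *\<^sub>R x) = k * form M z x"
  by (simp_all add: form_def algebra_simps inner_add_left inner_add_right
      matrix_vector_right_distrib matrix_vector_mult_scaleR)

lemma form_commute:
  assumes "transpose M = M"
  shows "form M x y = form M y x"
  unfolding form_def by (metis assms dot_lmul_matrix inner_commute transpose_matrix_vector)

lemma form_combination:
  assumes "transpose M = M"
  shows "form M (s *\<^sub>R p + t *\<^sub>R q) (s *\<^sub>R p + t *\<^sub>R q) =
    s\<^sup>2 * form M p p + 2 * s * t * form M p q + t\<^sup>2 * form M q q"
  using form_commute[OF assms, of q p]
  by (simp add: form_linear algebra_simps power2_eq_square)

lemma pt_in_conic_iff:
  assumes "v \<noteq> 0"
  shows "pt v \<in> conic_of M \<longleftrightarrow> form M v v = 0"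
proof -
  have "pt v \<in> conic_of M \<longleftrightarrow> (\<forall>k. form M (k *\<^sub>R v) (k *\<^sub>R v) = 0)"
    using assms by (auto simp: conic_of_def subspace_of_pt span_singleton form_def)
  also have "\<dots> \<longleftrightarrow> form M v v = 0"
    by (simp add: form_linear) (metis mult_1 one_neq_zero)
  finally show ?thesis .
qed

text \<open>
  The six values are the coefficients of the form in the basis \<open>a, b, c\<close>. A nonzero vector orthogonal to \<open>a\<close>, \<open>b\<close> and \<open>c\<close> would be the equation of a line
  through the three vertices, so \<open>M\<close> kills the vertices, and then, by symmetry, every vector.
\<close>

lemma form_zero_on_triangle:
  assumes M: "transpose M = M"
    and nz: "a \<noteq> 0" "b \<noteq> 0" "c \<noteq> 0" and tri: "\<not> proj_collinear (pt a) (pt b) (pt c)"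
    and "form M a a = 0" "form M b b = 0" "form M c c = 0"
    and "form M a b = 0" "form M b c = 0" "form M c a = 0"
  shows "M = 0"
proof -
  have orth: "n = 0" if "form M a v = 0" "form M b v = 0" "form M c v = 0" "n = M *v v" for n v
    using proj_collinear_if_orthogonal[OF nz, of n] tri that
    by (auto simp: form_def inner_commute)
  have "form M b a = 0" "form M c b = 0" "form M a c = 0"
    using assms form_commute[OF M] by metis+
  then have "M *v a = 0" "M *v b = 0" "M *v c = 0"
    using orth assms by blast+
  then have "form M a v = 0" "form M b v = 0" "form M c v = 0" for v
    using form_commute[OF M, of _ v] by (simp_all add: form_def)
  then have "M *v v = 0" for v
    by (rule orth) simp
  then show ?thesis
    by (simp add: matrix_eq)
qed

text \<open>
  On the line spanned by \<open>p\<close> and \<open>q\<close> the form is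
  \<open>s * (s * form M p p + 2 * t * form M p q)\<close> at \<open>s p + t q\<close>. The root \<open>s = 0\<close> is \<open>q\<close>, and \<open>d\<close>
  is the root of the other factor; on a tangent it is a multiple of \<open>q\<close>. It is nonzero because the
  form would otherwise vanish on the whole line, which has more than two points.
\<close>

lemma second_intersection_coordinates:
  assumes M: "transpose M = M" and nz: "p \<noteq> 0" "q \<noteq> 0" and q: "form M q q = 0"
    and X: "is_second_intersection X (conic_of M) (pt p) (pt q)"
  defines "d \<equiv> (2 * form M p q) *\<^sub>R p - form M p p *\<^sub>R q"
  shows "d \<noteq> 0" "X = pt d"
proof -
  have ne: "pt p \<noteq> pt q" and meet: "proj_line (pt p) (pt q) \<inter> conic_of M = {pt q, X}"
    using X by (auto simp: is_second_intersection_def)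
  have indep: "s = 0 \<and> t = 0" if "s *\<^sub>R p + t *\<^sub>R q = 0" for s t
  proof -
    have "s = 0"
    proof (rule ccontr)
      assume "s \<noteq> 0"
      then have "t \<noteq> 0" using that nz by auto
      have "pt p = pt (s *\<^sub>R p)" using \<open>s \<noteq> 0\<close> by (simp add: pt_scale)
      also have "s *\<^sub>R p = (- t) *\<^sub>R q" using that by (simp add: eq_neg_iff_add_eq_0)
      finally show False using ne \<open>t \<noteq> 0\<close> by (simp add: pt_scale del: scaleR_minus_left)
    qed
    then show ?thesis using that nz by simp
  qed
  have comb_eq_q: "s = 0" if eq: "pt (s *\<^sub>R p + t *\<^sub>R q) = pt q" and ne0: "s *\<^sub>R p + t *\<^sub>R q \<noteq> 0" for s t
  proof -
    obtain k where "s *\<^sub>R p + t *\<^sub>R q = k *\<^sub>R q"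
      using pt_eqD[OF eq ne0 nz(2)] .
    then have "s *\<^sub>R p + (t - k) *\<^sub>R q = 0" by (simp add: algebra_simps)
    then show ?thesis using indep by blast
  qed
  have on: "pt (s *\<^sub>R p + t *\<^sub>R q) \<in> {pt q, X}"
    if "s\<^sup>2 * form M p p + 2 * s * t * form M p q = 0" "s *\<^sub>R p + t *\<^sub>R q \<noteq> 0" for s t
    using that nz form_combination[OF M, of s p t q] q
    by (auto simp flip: meet simp: pt_in_proj_line_iff pt_in_conic_iff)
  have d_comb: "d = (2 * form M p q) *\<^sub>R p + (- form M p p) *\<^sub>R q"
    by (simp add: d_def)
  show d: "d \<noteq> 0"
  proof
    assume "d = 0"
    then have z: "form M p q = 0" "form M p p = 0"
      using indep[of "2 * form M p q" "- form M p p"] d_comb by auto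
    \<comment> \<open>Now the whole line lies on the conic, and \<open>q\<close>, \<open>p\<close>, \<open>p + q\<close> are three points of it.\<close>
    have "p + q \<noteq> 0" using indep[of 1 1] by auto
    have "pt p = X" using on[of 1 0] z nz ne by simp
    moreover have "pt (p + q) = X"
      using on[of 1 1] comb_eq_q[of 1 1] z \<open>p + q \<noteq> 0\<close> by auto
    ultimately obtain k where "p + q = k *\<^sub>R p"
      using pt_eqD[of "p + q" p] \<open>p + q \<noteq> 0\<close> nz by metis
    then have "(1 - k) *\<^sub>R p + 1 *\<^sub>R q = 0" by (simp add: algebra_simps)
    then show False using indep by fastforce
  qed
  have "pt d \<in> {pt q, X}"
    using on[of "2 * form M p q" "- form M p p"] d unfolding d_comb
    by (simp add: power2_eq_square)
  \<comment> \<open>The tangent case: the form has a double root at \<open>q\<close>, so the line has no other common point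
      with the conic.\<close>
  moreover have "X = pt q" if "pt d = pt q"
  proof -
    have pq: "form M p q = 0" and pp: "form M p p \<noteq> 0"
      using comb_eq_q that d unfolding d_comb by (fastforce, fastforce)
    obtain x where x: "x \<noteq> 0" "X = pt x" by (rule proj_point_cases)
    have "pt x \<in> proj_line (pt p) (pt q)" "form M x x = 0"
      using meet x pt_in_conic_iff by auto
    then obtain s t where st: "x = s *\<^sub>R p + t *\<^sub>R q" "form M x x = 0"
      using x nz pt_in_proj_line_iff by blast
    then have "s = 0"
      using form_combination[OF M, of s p t q] pq pp q by simp
    then show ?thesis using st x pt_scale by force
  qed
  ultimately show "X = pt d" by auto
qed

section \<open>The two points of the conic on a side\<close>

text \<open>
  The hypotheses that involve one side \<open>BC\<close> only, collected so that the symmetry between the two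
  points on it and the cyclic symmetry of the triangle can be applied as rules.
\<close>

definition side_points :: "proj_point set \<Rightarrow> proj_point \<Rightarrow> proj_point \<Rightarrow> proj_point \<Rightarrow>
    proj_point \<Rightarrow> proj_point \<Rightarrow> proj_point \<Rightarrow> proj_point \<Rightarrow> bool" where
  "side_points K A B C A1 A2 D1 D2 \<longleftrightarrow>
     A1 \<noteq> A2 \<and> {A1, A2} \<subseteq> proj_line B C \<inter> K \<and> {A1, A2} \<inter> {B, C} = {} \<and>
     is_second_intersection D1 K A A1 \<and> is_second_intersection D2 K A A2"

lemma side_points_swap:
  "side_points K A B C A1 A2 D1 D2 \<Longrightarrow> side_points K A B C A2 A1 D2 D1"
  by (auto simp: side_points_def)

lemma side_point_coordinate:
  assumes nz: "b \<noteq> 0" "c \<noteq> 0" and X: "X \<in> proj_line (pt b) (pt c)" "X \<noteq> pt b" "X \<noteq> pt c"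
  obtains u where "u \<noteq> 0" "b + u *\<^sub>R c \<noteq> 0" "X = pt (b + u *\<^sub>R c)"
proof -
  obtain x where x: "x \<noteq> 0" "X = pt x" by (rule proj_point_cases)
  then obtain s t where st: "x = s *\<^sub>R b + t *\<^sub>R c"
    using X nz pt_in_proj_line_iff by blast
  have s: "s \<noteq> 0" and t: "t \<noteq> 0"
    using X x st by (auto simp: pt_scale)
  have "x = s *\<^sub>R (b + (t / s) *\<^sub>R c)"
    using st s by (simp add: algebra_simps)
  with s t x that[of "t / s"] show thesis
    by (metis divide_eq_0_iff pt_scale scaleR_zero_right)
qed

text \<open>
  The restriction of the form to the side \<open>bc\<close> has the two distinct roots \<open>u1\<close> and \<open>u2\<close>, so its
  coefficients are determined by Vieta's formulas up to the factor \<open>form M c c\<close>. This also holds if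
  that factor is zero, in which case the form vanishes on the side.
\<close>

lemma side_points_coordinates:
  assumes M: "transpose M = M" and nz: "a \<noteq> 0" "b \<noteq> 0" "c \<noteq> 0"
    and side: "side_points (conic_of M) (pt a) (pt b) (pt c) A1 A2 D1 D2"
  obtains u1 u2 where "u1 \<noteq> 0" "u2 \<noteq> 0"
    "b + u1 *\<^sub>R c \<noteq> 0" "A1 = pt (b + u1 *\<^sub>R c)" "b + u2 *\<^sub>R c \<noteq> 0" "A2 = pt (b + u2 *\<^sub>R c)"
    "2 * form M b c = - (u1 + u2) * form M c c" "form M b b = u1 * u2 * form M c c"
    "(2 * form M a (b + u1 *\<^sub>R c)) *\<^sub>R a - form M a a *\<^sub>R (b + u1 *\<^sub>R c) \<noteq> 0"
    "D1 = pt ((2 * form M a (b + u1 *\<^sub>R c)) *\<^sub>R a - form M a a *\<^sub>R (b + u1 *\<^sub>R c))"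
    "(2 * form M a (b + u2 *\<^sub>R c)) *\<^sub>R a - form M a a *\<^sub>R (b + u2 *\<^sub>R c) \<noteq> 0"
    "D2 = pt ((2 * form M a (b + u2 *\<^sub>R c)) *\<^sub>R a - form M a a *\<^sub>R (b + u2 *\<^sub>R c))"
proof -
  have side': "A1 \<noteq> A2" "A1 \<in> proj_line (pt b) (pt c)" "A2 \<in> proj_line (pt b) (pt c)"
    "A1 \<noteq> pt b" "A1 \<noteq> pt c" "A2 \<noteq> pt b" "A2 \<noteq> pt c" "A1 \<in> conic_of M" "A2 \<in> conic_of M"
    "is_second_intersection D1 (conic_of M) (pt a) A1"
    "is_second_intersection D2 (conic_of M) (pt a) A2"
    using side by (auto simp: side_points_def)
  obtain u1 where u1: "u1 \<noteq> 0" "b + u1 *\<^sub>R c \<noteq> 0" "A1 = pt (b + u1 *\<^sub>R c)"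
    using side_point_coordinate[OF nz(2,3) side'(2,4,5)] .
  obtain u2 where u2: "u2 \<noteq> 0" "b + u2 *\<^sub>R c \<noteq> 0" "A2 = pt (b + u2 *\<^sub>R c)"
    using side_point_coordinate[OF nz(2,3) side'(3,6,7)] .
  have zero: "form M (b + u1 *\<^sub>R c) (b + u1 *\<^sub>R c) = 0" "form M (b + u2 *\<^sub>R c) (b + u2 *\<^sub>R c) = 0"
    using u1 u2 side'(8,9) pt_in_conic_iff by auto
  have root: "form M b b + 2 * u * form M b c + u\<^sup>2 * form M c c = 0"
    if "form M (b + u *\<^sub>R c) (b + u *\<^sub>R c) = 0" for u
    using form_combination[OF M, of 1 b u c] that by simp
  \<comment> \<open>Subtracting the two equations leaves the factor \<open>u1 - u2\<close>, which can be cancelled.\<close>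
  have "u1 \<noteq> u2" using side'(1) u1 u2 by auto
  moreover have "(u1 - u2) * (2 * form M b c + (u1 + u2) * form M c c) = 0"
    using root[OF zero(1)] root[OF zero(2)] by (simp add: algebra_simps power2_eq_square)
  ultimately have "2 * form M b c + (u1 + u2) * form M c c = 0"
    by simp
  then have bc: "2 * form M b c = - (u1 + u2) * form M c c"
    unfolding mult_minus_left by linarith
  have bb: "form M b b = u1 * u2 * form M c c"
  proof -
    have "2 * u1 * form M b c = u1 * (- (u1 + u2) * form M c c)"
      using bc by (simp add: mult.assoc mult.left_commute)
    then show ?thesis
      using root[OF zero(1)] by (simp add: algebra_simps power2_eq_square)
  qed
  show thesis
    using that[OF u1(1) u2(1) u1(2,3) u2(2,3) bc bb]
      second_intersection_coordinates[OF M nz(1) u1(2) zero(1)]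
      second_intersection_coordinates[OF M nz(1) u2(2) zero(2)] side'(10,11) u1(3) u2(3)
    by blast
qed

section \<open>Two applications of Pascal's theorem\<close>

lemma intersection_unique:
  assumes "is_intersection X P Q R S" "Y \<in> proj_line P Q" "Y \<in> proj_line R S"
  shows "X = Y"
  using assms by (auto simp: is_intersection_def)

text \<open>
  The line through \<open>C1 = a + w1 b\<close> and \<open>B2 = c + v2 a\<close> meets the side \<open>bc\<close> where \<open>a\<close> is
  eliminated, in \<open>v2 w1 b - c\<close>. In the first use of Pascal's theorem the chord \<open>E1F2\<close> passes
  through the same point. The reason here is that eliminating \<open>a\<close> from \<open>e1\<close> and \<open>f2\<close> gives
  \<open>\<kappa>\<close> times the same vector. The factor is nonzero, as otherwise \<open>E1 = F2\<close> and the chord would not be defined.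
\<close>

lemma intersection_on_side:
  assumes x: "(v2 * w1) *\<^sub>R b - c \<noteq> 0"
    and M: "transpose M = M"
    and v1: "v1 \<noteq> 0" and bb: "form M b b \<noteq> 0" and cc: "form M c c \<noteq> 0"
    and bc: "2 * form M b c = - (u1 + u2) * form M c c"
    and ca: "2 * form M c a = - (v1 + v2) * form M a a" "form M c c = v1 * v2 * form M a a"
    and ab: "2 * form M a b = - (w1 + w2) * form M b b" "form M a a = w1 * w2 * form M b b"
    and nz: "a + w1 *\<^sub>R b \<noteq> 0" "c + v2 *\<^sub>R a \<noteq> 0" "e1 \<noteq> 0" "f2 \<noteq> 0"
    and e1: "e1 = (2 * form M b (c + v1 *\<^sub>R a)) *\<^sub>R b - form M b b *\<^sub>R (c + v1 *\<^sub>R a)"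
    and f2: "f2 = (2 * form M c (a + w2 *\<^sub>R b)) *\<^sub>R c - form M c c *\<^sub>R (a + w2 *\<^sub>R b)"
    and X: "is_intersection X (pt (a + w1 *\<^sub>R b)) (pt (c + v2 *\<^sub>R a)) (pt e1) (pt f2)"
  shows "X = pt ((v2 * w1) *\<^sub>R b - c)"
proof -
  let ?x = "(v2 * w1) *\<^sub>R b - c"
  \<comment> \<open>\<open>- \<kappa>\<close> is the coefficient of \<open>c\<close> in \<open>form M c c * e1 - v1 * form M b b * f2\<close>, the combination
      in which \<open>a\<close> cancels.\<close>
  define \<kappa> where "\<kappa> = - form M b b * (v1\<^sup>2 * form M a a + w2 * v1 * (u1 + u2) * form M c c)"
  have sym: "form M b a = form M a b" "form M c b = form M b c"
    using form_commute[OF M] by auto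
  have coeff_b: "form M c c * (2 * form M b (c + v1 *\<^sub>R a)) + v1 * w2 * form M b b * form M c c
      = \<kappa> * (v2 * w1)"
  proof -
    have "2 * form M b (c + v1 *\<^sub>R a) = 2 * form M b c + v1 * (2 * form M a b)"
      by (simp add: form_linear sym)
    also have "\<dots> = - (u1 + u2) * form M c c - v1 * (w1 + w2) * form M b b"
      unfolding bc ab(1) by (simp add: algebra_simps)
    finally have expand: "2 * form M b (c + v1 *\<^sub>R a) =
      - (u1 + u2) * form M c c - v1 * (w1 + w2) * form M b b" .
    show ?thesis
      unfolding \<kappa>_def expand ca(2) ab(2) by (simp add: algebra_simps power2_eq_square)
  qed
  have coeff_c: "- form M b b * form M c c - v1 * form M b b * (2 * form M c (a + w2 *\<^sub>R b)) = - \<kappa>"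
  proof -
    have "2 * form M c (a + w2 *\<^sub>R b) = 2 * form M c a + w2 * (2 * form M b c)"
      by (simp add: form_linear sym)
    also have "\<dots> = - (v1 + v2) * form M a a - w2 * (u1 + u2) * form M c c"
      unfolding bc ca(1) by (simp add: algebra_simps)
    finally have expand: "2 * form M c (a + w2 *\<^sub>R b) =
      - (v1 + v2) * form M a a - w2 * (u1 + u2) * form M c c" .
    show ?thesis
      unfolding \<kappa>_def expand ca(2) by (simp add: algebra_simps power2_eq_square)
  qed
  have "form M c c *\<^sub>R e1 - (v1 * form M b b) *\<^sub>R f2 =
      (form M c c * (2 * form M b (c + v1 *\<^sub>R a)) + v1 * w2 * form M b b * form M c c) *\<^sub>R b +
      (- form M b b * form M c c - v1 * form M b b * (2 * form M c (a + w2 *\<^sub>R b))) *\<^sub>R c"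
    unfolding e1 f2 by (simp add: algebra_simps)
  also have "\<dots> = \<kappa> *\<^sub>R ?x"
    unfolding coeff_b coeff_c by (simp add: algebra_simps)
  finally have key: "form M c c *\<^sub>R e1 - (v1 * form M b b) *\<^sub>R f2 = \<kappa> *\<^sub>R ?x" .
  have "\<kappa> \<noteq> 0"
  proof
    assume "\<kappa> = 0"
    with key have "form M c c *\<^sub>R e1 = (v1 * form M b b) *\<^sub>R f2" by simp
    then have "pt e1 = pt f2"
      using cc bb v1 by (metis mult_eq_0_iff pt_scale)
    with X show False by (simp add: is_intersection_def)
  qed
  have "(1 / \<kappa>) *\<^sub>R (\<kappa> *\<^sub>R ?x) =
      (form M c c / \<kappa>) *\<^sub>R e1 + (- (v1 * form M b b) / \<kappa>) *\<^sub>R f2"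
    unfolding key[symmetric] by (simp add: algebra_simps)
  then have "?x = (form M c c / \<kappa>) *\<^sub>R e1 + (- (v1 * form M b b) / \<kappa>) *\<^sub>R f2"
    using \<open>\<kappa> \<noteq> 0\<close> by simp
  then have "pt ?x \<in> proj_line (pt e1) (pt f2)"
    using x nz pt_in_proj_line_iff by blast
  moreover have "?x = v2 *\<^sub>R (a + w1 *\<^sub>R b) + (- 1) *\<^sub>R (c + v2 *\<^sub>R a)"
    by (simp add: algebra_simps)
  then have "pt ?x \<in> proj_line (pt (a + w1 *\<^sub>R b)) (pt (c + v2 *\<^sub>R a))"
    using x nz pt_in_proj_line_iff by blast
  ultimately show "X = pt ?x"
    using X intersection_unique by blast
qed

text \<open>
  The three points are \<open>v2 w1 b - c\<close>, \<open>w2 u1 c - a\<close> and \<open>u2 v1 a - b\<close>, by \<open>intersection_on_side\<close>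
  and its two cyclic rotations. The determinant of their coordinates is Carnot's product minus 1.
\<close>

lemma pascal_triple_collinear:
  assumes triangle: "\<not> proj_collinear A B C" and conic: "is_conic K"
    and sA: "side_points K A B C A1 A2 D1 D2"
    and sB: "side_points K B C A B1 B2 E1 E2"
    and sC: "side_points K C A B C1 C2 F1 F2"
    and X: "is_intersection X C1 B2 E1 F2"
    and Y: "is_intersection Y A1 C2 F1 D2"
    and Z: "is_intersection Z B1 A2 D1 E2"
  shows "proj_collinear X Y Z"
proof -
  obtain M where M: "transpose M = M" "M \<noteq> 0" and K: "K = conic_of M"
    using conic by (auto simp: is_conic_def conic_of_def)
  obtain a where a: "a \<noteq> 0" "A = pt a" by (rule proj_point_cases)
  obtain b where b: "b \<noteq> 0" "B = pt b" by (rule proj_point_cases)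
  obtain c where c: "c \<noteq> 0" "C = pt c" by (rule proj_point_cases)
  have tri: "\<not> proj_collinear (pt a) (pt b) (pt c)"
    using triangle a b c by simp
  note indep = triangle_independent[OF tri a(1) b(1) c(1)]
  obtain u1 u2 where u: "u1 \<noteq> 0" "u2 \<noteq> 0"
    "b + u1 *\<^sub>R c \<noteq> 0" "A1 = pt (b + u1 *\<^sub>R c)" "b + u2 *\<^sub>R c \<noteq> 0" "A2 = pt (b + u2 *\<^sub>R c)"
    "2 * form M b c = - (u1 + u2) * form M c c" "form M b b = u1 * u2 * form M c c"
    "(2 * form M a (b + u1 *\<^sub>R c)) *\<^sub>R a - form M a a *\<^sub>R (b + u1 *\<^sub>R c) \<noteq> 0"
    "D1 = pt ((2 * form M a (b + u1 *\<^sub>R c)) *\<^sub>R a - form M a a *\<^sub>R (b + u1 *\<^sub>R c))"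
    "(2 * form M a (b + u2 *\<^sub>R c)) *\<^sub>R a - form M a a *\<^sub>R (b + u2 *\<^sub>R c) \<noteq> 0"
    "D2 = pt ((2 * form M a (b + u2 *\<^sub>R c)) *\<^sub>R a - form M a a *\<^sub>R (b + u2 *\<^sub>R c))"
    by (rule side_points_coordinates[OF M(1) a(1) b(1) c(1) sA[unfolded K a(2) b(2) c(2)]])
  obtain v1 v2 where v: "v1 \<noteq> 0" "v2 \<noteq> 0"
    "c + v1 *\<^sub>R a \<noteq> 0" "B1 = pt (c + v1 *\<^sub>R a)" "c + v2 *\<^sub>R a \<noteq> 0" "B2 = pt (c + v2 *\<^sub>R a)"
    "2 * form M c a = - (v1 + v2) * form M a a" "form M c c = v1 * v2 * form M a a"
    "(2 * form M b (c + v1 *\<^sub>R a)) *\<^sub>R b - form M b b *\<^sub>R (c + v1 *\<^sub>R a) \<noteq> 0"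
    "E1 = pt ((2 * form M b (c + v1 *\<^sub>R a)) *\<^sub>R b - form M b b *\<^sub>R (c + v1 *\<^sub>R a))"
    "(2 * form M b (c + v2 *\<^sub>R a)) *\<^sub>R b - form M b b *\<^sub>R (c + v2 *\<^sub>R a) \<noteq> 0"
    "E2 = pt ((2 * form M b (c + v2 *\<^sub>R a)) *\<^sub>R b - form M b b *\<^sub>R (c + v2 *\<^sub>R a))"
    by (rule side_points_coordinates[OF M(1) b(1) c(1) a(1) sB[unfolded K a(2) b(2) c(2)]])
  obtain w1 w2 where w: "w1 \<noteq> 0" "w2 \<noteq> 0"
    "a + w1 *\<^sub>R b \<noteq> 0" "C1 = pt (a + w1 *\<^sub>R b)" "a + w2 *\<^sub>R b \<noteq> 0" "C2 = pt (a + w2 *\<^sub>R b)"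
    "2 * form M a b = - (w1 + w2) * form M b b" "form M a a = w1 * w2 * form M b b"
    "(2 * form M c (a + w1 *\<^sub>R b)) *\<^sub>R c - form M c c *\<^sub>R (a + w1 *\<^sub>R b) \<noteq> 0"
    "F1 = pt ((2 * form M c (a + w1 *\<^sub>R b)) *\<^sub>R c - form M c c *\<^sub>R (a + w1 *\<^sub>R b))"
    "(2 * form M c (a + w2 *\<^sub>R b)) *\<^sub>R c - form M c c *\<^sub>R (a + w2 *\<^sub>R b) \<noteq> 0"
    "F2 = pt ((2 * form M c (a + w2 *\<^sub>R b)) *\<^sub>R c - form M c c *\<^sub>R (a + w2 *\<^sub>R b))"
    by (rule side_points_coordinates[OF M(1) c(1) a(1) b(1) sC[unfolded K a(2) b(2) c(2)]])
  \<comment> \<open>If one vertex were on the conic, the whole form would vanish.\<close>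
  have aa: "form M a a \<noteq> 0"
  proof
    assume "form M a a = 0"
    then have "form M c c = 0" "form M b b = 0"
      using v(8) u(8) by simp_all
    then have "M = 0"
      using \<open>form M a a = 0\<close> u(7) v(7) w(7)
      by (intro form_zero_on_triangle[OF M(1) a(1) b(1) c(1) tri]) simp_all
    with M(2) show False by simp
  qed
  then have bb: "form M b b \<noteq> 0" and cc: "form M c c \<noteq> 0"
    using w(8) v(8) v(1,2) by auto
  \<comment> \<open>Carnot's relation comes from multiplying the ratios of the three diagonal coefficients.\<close>
  have "form M a a * (u1 * u2 * v1 * v2 * w1 * w2) = form M a a"
  proof -
    have "form M a a = w1 * w2 * (u1 * u2 * (v1 * v2 * form M a a))"
      using u(8) v(8) w(8) by simp
    then show ?thesis by (simp add: mult_ac)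
  qed
  with aa have carnot: "u1 * u2 * v1 * v2 * w1 * w2 = 1" by simp
  have x: "(v2 * w1) *\<^sub>R b - c \<noteq> 0"
    using indep[of 0 "v2 * w1" "-1"] by auto
  have y: "(w2 * u1) *\<^sub>R c - a \<noteq> 0"
    using indep[of "-1" 0 "w2 * u1"] by auto
  have z: "(u2 * v1) *\<^sub>R a - b \<noteq> 0"
    using indep[of "u2 * v1" "-1" 0] by auto
  note X_eq = intersection_on_side[OF x M(1) v(1) bb cc u(7) v(7,8) w(7,8)
      w(3) v(5) v(9) w(11) refl refl X[unfolded w(4) v(6,10) w(12)]]
  note Y_eq = intersection_on_side[OF y M(1) w(1) cc aa v(7) w(7,8) u(7,8)
      u(3) w(5) w(9) u(11) refl refl Y[unfolded u(4) w(6,10) u(12)]]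
  note Z_eq = intersection_on_side[OF z M(1) u(1) aa bb w(7) u(7,8) v(7,8)
      v(3) u(5) u(9) v(11) refl refl Z[unfolded v(4) u(6,10) v(12)]]
  have "(v2 * w1) *\<^sub>R b - c =
      (- (v2 * w1) * (u2 * v1)) *\<^sub>R ((w2 * u1) *\<^sub>R c - a) + (- (v2 * w1)) *\<^sub>R ((u2 * v1) *\<^sub>R a - b)"
  proof -
    have "(v2 * w1) * (u2 * v1) * (w2 * u1) = 1"
      using carnot by (simp add: mult.assoc mult.commute mult.left_commute)
    then show ?thesis
      by (simp add: scaleR_right_diff_distrib)
  qed
  then have "proj_collinear (pt ((v2 * w1) *\<^sub>R b - c)) (pt ((w2 * u1) *\<^sub>R c - a))
      (pt ((u2 * v1) *\<^sub>R a - b))"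
    by (rule proj_collinear_if_dependent[OF x y z])
  then show ?thesis
    using X_eq Y_eq Z_eq by simp
qed

section \<open>The eight triples\<close>

lemma proj_line_commute: "proj_line P Q = proj_line Q P"
  by (simp add: proj_line_def Un_commute)

lemma is_intersection_commute:
  "is_intersection X P Q R S \<Longrightarrow> is_intersection X Q P R S"
  "is_intersection X P Q R S \<Longrightarrow> is_intersection X P Q S R"
  by (auto simp: is_intersection_def proj_line_commute)

theorem theorem2p2:
  fixes A B C A1 A2 B1 B2 C1 C2 D1 D2 E1 E2 F1 F2 :: proj_point
    and A3 A4 B3 B4 C3 C4 D3 D4 E3 E4 F3 F4 :: proj_point
    and K :: "proj_point set"
  assumes triangle: "\<not> proj_collinear A B C"
    and on_BC: "A1 \<in> proj_line B C" "A2 \<in> proj_line B C"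
    and on_CA: "B1 \<in> proj_line C A" "B2 \<in> proj_line C A"
    and on_AB: "C1 \<in> proj_line A B" "C2 \<in> proj_line A B"
    and distinct_points: "distinct [A1, A2, B1, B2, C1, C2]"
    and not_vertices: "{A1, A2, B1, B2, C1, C2} \<inter> {A, B, C} = {}"
    and conic: "is_conic K"
    and on_conic: "{A1, A2, B1, B2, C1, C2} \<subseteq> K"
    and D1: "is_second_intersection D1 K A A1"
    and D2: "is_second_intersection D2 K A A2"
    and E1: "is_second_intersection E1 K B B1"
    and E2: "is_second_intersection E2 K B B2"
    and F1: "is_second_intersection F1 K C C1"
    and F2: "is_second_intersection F2 K C C2"
    and A3: "is_intersection A3 C1 B2 E1 F2"
    and A4: "is_intersection A4 B1 C2 F1 E2"
    and B3: "is_intersection B3 A1 C2 F1 D2"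
    and B4: "is_intersection B4 C1 A2 D1 F2"
    and C3: "is_intersection C3 B1 A2 D1 E2"
    and C4: "is_intersection C4 A1 B2 E1 D2"
    and D3: "is_intersection D3 B1 C1 E2 F2"
    and D4: "is_intersection D4 B2 C2 E1 F1"
    and E3: "is_intersection E3 A1 C1 D2 F2"
    and E4: "is_intersection E4 A2 C2 D1 F1"
    and F3: "is_intersection F3 A1 B1 D2 E2"
    and F4: "is_intersection F4 A2 B2 D1 E1"
  shows "proj_collinear A3 B3 C3 \<and>
         proj_collinear D3 E4 C4 \<and>
         proj_collinear A3 E4 F3 \<and>
         proj_collinear D3 B3 F4 \<and>
         proj_collinear A4 E3 F4 \<and>
         proj_collinear D4 E3 C3 \<and>
         proj_collinear D4 B4 F3 \<and>
         proj_collinear A4 B4 C4"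
proof -
  have sA: "side_points K A B C A1 A2 D1 D2"
    using on_BC distinct_points not_vertices on_conic D1 D2 by (auto simp: side_points_def)
  have sB: "side_points K B C A B1 B2 E1 E2"
    using on_CA distinct_points not_vertices on_conic E1 E2 by (auto simp: side_points_def)
  have sC: "side_points K C A B C1 C2 F1 F2"
    using on_AB distinct_points not_vertices on_conic F1 F2 by (auto simp: side_points_def)
  note sA' = side_points_swap[OF sA] and sB' = side_points_swap[OF sB]
    and sC' = side_points_swap[OF sC]
  note triple = pascal_triple_collinear[OF triangle conic]
  \<comment> \<open>The remaining nine intersection points, with their lines read in the direction that the
      exchanges produce.\<close>
  note swap_first = is_intersection_commute(1) and swap_second = is_intersection_commute(2)
  note D3' = swap_first[OF D3] and D4' = swap_first[OF D4]
    and F3' = swap_first[OF F3] and F4' = swap_first[OF F4]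
  note E3' = swap_second[OF E3] and E4' = swap_second[OF E4]
  note A4' = swap_first[OF swap_second[OF A4]] and B4' = swap_first[OF swap_second[OF B4]]
    and C4' = swap_first[OF swap_second[OF C4]]
  show ?thesis
  proof (intro conjI)
    show "proj_collinear A3 B3 C3"
      by (rule triple[OF sA sB sC A3 B3 C3])
    show "proj_collinear D3 E4 C4"
      by (rule triple[OF sA' sB' sC D3' E4' C4'])
    show "proj_collinear A3 E4 F3"
      by (rule triple[OF sA' sB sC A3 E4' F3'])
    show "proj_collinear D3 B3 F4"
      by (rule triple[OF sA sB' sC D3' B3 F4'])
    show "proj_collinear A4 E3 F4"
      by (rule triple[OF sA sB' sC' A4' E3' F4'])
    show "proj_collinear D4 E3 C3"
      by (rule triple[OF sA sB sC' D4' E3' C3])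
    show "proj_collinear D4 B4 F3"
      by (rule triple[OF sA' sB sC' D4' B4' F3'])
    show "proj_collinear A4 B4 C4"
      by (rule triple[OF sA' sB' sC' A4' B4' C4'])
  qed
qed

end
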